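(* Suppose $(P,Q,R)$ satisfies the system associated to the generalised Chazy equation with parameter $k=2$: $$P'=\tfrac16(P^2-Q),\qquad Q'=\tfrac23(PQ-R),\qquad R'=PR+\tfrac18Q^2.$$ Then the following holds. (1) The triples $$\left(P-\frac{Q^2}{4R},\;-Q-\frac{Q^4}{8R^2},\;-R-\frac{Q^3}{4R}-\frac{Q^6}{64R^3}\right)$$ and $$\left(P-2\nu,\;\frac{5}{3}Q+\frac{64}{3}\mu^2-8\nu^2,\;-\frac{7}{27}R-\frac{4}{3}Q\mu-2Q\nu-\frac{Q^2}{R}\nu^2-\frac{2}{27}\frac{Q^3}{R}\right)$$ both satisfy the same system (parameter $k=2$), where $\nu$ and $\mu$ are roots of the cubic equations $$\mu^3+\frac{3}{32}Q\mu+\frac{R}{32}=0,\qquad \nu^3-\frac{1}{8}\frac{Q^2}{R}\nu^2-\frac{1}{108}\frac{Q^3}{R}-\frac{2}{27}R=0,$$ and $\nu$ is related to $\mu$ by $\nu=-\frac{4}{3}\mu-\frac{Q}{24\mu}$. (2) Furthermore, let $$\chi=\frac{R}{2Q}\pm\frac{1}{2}\sqrt{\frac{R^2}{Q^2}+\frac{Q}{8}}.$$ Then (for either choice of sign) the triple $$(p,q,r)=\left(P+\chi,\;\frac{3}{4}Q-3\chi^2,\;\frac{3}{4}R+\frac{9}{8}Q\chi+3\chi^3\right)$$ solves the system associated to the generalised Chazy equation with parameter $k=3$, i.e. $p'=\frac16(p^2-q)$, $q'=\frac23(pq-r)$, $r'=pr+\frac13q^2$.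
   Context: The first order system associated to the generalised Chazy equation with parameter $k$, for functions $P,Q,R$ of $x$ (with $'=d/dx$), is $$P'=\tfrac16(P^2-Q),\qquad Q'=\tfrac23(PQ-R),\qquad R'=PR+\frac{k^2}{36-k^2}Q^2;$$ a triple "satisfies the system with parameter $k$" if its first, second and third entries satisfy these equations in the roles of $P,Q,R$. Quantities introduced as roots of polynomial equations, or through square roots, are differentiable functions of $x$ (branches) satisfying the defining relations identically in $x$, and all statements are understood where the displayed denominators are nonzero. *)

theory Defs
  imports "HOL-Analysis.Analysis"
begin

text \<open>
  The class \<^class>\<open>real_normed_field\<close> covers a real variable (\<^typ>\<open>real\<close>) and a complex variable
  (\<^typ>\<open>complex\<close>, where the derivative is the holomorphic one) at once.  \<open>S\<close> is the domain of
  definition and is meant to be open.  Values of \<open>k\<close> with \<open>k\<^sup>2 = 36\<close> are excluded mathematically.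
\<close>

definition chazy_system ::
  "'a::real_normed_field \<Rightarrow> 'a set \<Rightarrow> ('a \<Rightarrow> 'a) \<Rightarrow> ('a \<Rightarrow> 'a) \<Rightarrow> ('a \<Rightarrow> 'a) \<Rightarrow> bool" where
  "chazy_system k S P Q R \<longleftrightarrow>
     (\<forall>x\<in>S.
        (P has_field_derivative (1/6) * ((P x)^2 - Q x)) (at x) \<and>
        (Q has_field_derivative (2/3) * (P x * Q x - R x)) (at x) \<and>
        (R has_field_derivative P x * R x + k^2 / (36 - k^2) * (Q x)^2) (at x))"

end

theory Submission
  imports Defs
begin

text \<open>
  Give \<open>P\<close>, \<open>Q\<close>, \<open>R\<close> the weights 1, 2, 3; the system is then homogeneous, a derivative raising
  the weight by one.  Each of the three transformations is built from an auxiliary function of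
  weight one that is algebraic over \<open>Q\<close> and \<open>R\<close>: \<open>w = Q\<^sup>2/(4R)\<close> for the rational triple, \<open>\<mu>\<close> and \<open>\<nu>\<close>
  for the cubic one, and \<open>\<chi>\<close>, a root of \<open>\<chi>\<^sup>2 - (R/Q)\<chi> - Q/32 = 0\<close>, for the passage to parameter 3.
  The decisive point is that each of them satisfies a Riccati equation with polynomial
  coefficients:
  \<^item> \<open>w' = P w/3 - Q/3 - w\<^sup>2/2\<close>,
  \<^item> \<open>\<mu>' = P \<mu>/3 - 2/3 (\<mu>\<^sup>2 + Q/16)\<close>,
  \<^item> \<open>\<chi>' = P \<chi>/3 + 2/3 \<chi>\<^sup>2 + Q/24\<close>.

  The new triples are polynomials in \<open>P, Q, R\<close> and these functions, so that the new system
  reduces to polynomial identities modulo the algebraic relations.  The lemmas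
  \<open>chazy2_involution\<close>, \<open>chazy2_factored\<close> and \<open>chazy2_to_chazy3\<close> carry out these reductions.  For the
  cubic triple, \<open>\<mu>\<close> and \<open>\<nu>\<close> serve as coordinates: the relation between them and the cubic of \<open>\<mu>\<close>
  say that \<open>Q = -8\<mu>(4\<mu> + 3\<nu>)\<close> and \<open>R = 8\<mu>\<^sup>2(8\<mu> + 9\<nu>)\<close>, so no relation is left, and \<open>\<mu>, \<nu>\<close>
  evolve by equations of Lotka-Volterra type.

  The equations for \<open>\<mu>\<close> and \<open>\<chi>\<close> come from differentiating the defining polynomial, which
  determines the derivative of a branch only where the root is simple.  A multiple root makes
  \<open>\<Delta> = 8R\<^sup>2 + Q\<^sup>3\<close> vanish.  But \<open>\<Delta>' = 2P\<Delta>\<close>, so a zero of \<open>\<Delta>\<close> forces \<open>\<Delta>\<close> to vanish on a whole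
  neighbourhood (\<open>chazy2_discriminant_zero_near_zero\<close>); there the branch is a double root
  throughout, hence an explicit rational function of \<open>Q\<close> and \<open>R\<close> that can be differentiated
  directly.
\<close>

section \<open>Solutions of the system\<close>

lemma chazy_systemD:
  assumes "chazy_system k S P Q R" and "x \<in> S"
  shows "(P has_field_derivative (1/6) * ((P x)^2 - Q x)) (at x)"
    and "(Q has_field_derivative (2/3) * (P x * Q x - R x)) (at x)"
    and "(R has_field_derivative P x * R x + k^2 / (36 - k^2) * (Q x)^2) (at x)"
  using assms by (auto simp: chazy_system_def)

lemma chazy_system_cong_open:
  assumes "open S" and "chazy_system k S p q r"
    and "\<And>x. x \<in> S \<Longrightarrow> P x = p x" and "\<And>x. x \<in> S \<Longrightarrow> Q x = q x" and "\<And>x. x \<in> S \<Longrightarrow> R x = r x"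
  shows "chazy_system k S P Q R"
  unfolding chazy_system_def
proof (intro ballI conjI)
  fix x assume x: "x \<in> S"
  note D = chazy_systemD[OF assms(2) x]
  note transfer = has_field_derivative_transform_within_open[OF _ \<open>open S\<close> x]
  show "(P has_field_derivative (1/6) * ((P x)^2 - Q x)) (at x)"
    using transfer[OF D(1), of P] assms(3-5) x by simp
  show "(Q has_field_derivative (2/3) * (P x * Q x - R x)) (at x)"
    using transfer[OF D(2), of Q] assms(3-5) x by simp
  show "(R has_field_derivative P x * R x + k^2 / (36 - k^2) * (Q x)^2) (at x)"
    using transfer[OF D(3), of R] assms(3-5) x by simp
qed

text \<open>
  These rules discharge the side conditions of the quotient rule during differentiation: every
  denominator below is built from numerals and nonvanishing functions by products and powers.
\<close>

lemmas nonzero_denominator = zero_neq_numeral[symmetric] no_zero_divisors power_not_zero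

section \<open>Propagation of zeros of the discriminant\<close>

text \<open>
  Uniqueness for \<open>f' = a f\<close> with initial value zero.  The mean value inequality on a ball of
  radius \<open>\<rho>\<close> bounds \<open>f\<close> by \<open>\<rho> sup |a|\<close> times any bound that it already has; once \<open>\<rho> sup |a| \<le> 1/2\<close>,
  the bound can be halved indefinitely.  An integrating factor would require the field to be
  complete.
\<close>

lemma linear_ode_solution_zero_near_zero:
  fixes f a :: "'a::real_normed_field \<Rightarrow> 'a"
  assumes "open S" and "x \<in> S"
    and deriv: "\<And>z. z \<in> S \<Longrightarrow> (f has_field_derivative a z * f z) (at z)"
    and cont: "isCont a x" and "f x = 0"
  obtains U where "open U" "x \<in> U" "U \<subseteq> S" "\<And>z. z \<in> U \<Longrightarrow> f z = 0"
proof -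
  define M where "M = norm (a x) + 1"
  have "M > 0" by (simp add: M_def add_nonneg_pos)
  have tendsto_nhds: "(g \<longlongrightarrow> g x) (nhds x)" if "isCont g x" for g :: "'a \<Rightarrow> 'a"
    using that by (simp add: isCont_def tendsto_at_iff_tendsto_nhds)
  have "\<forall>\<^sub>F z in nhds x. norm (a z) < M"
    by (rule order_tendstoD(2)[OF tendsto_norm[OF tendsto_nhds[OF cont]]]) (simp add: M_def)
  moreover have "\<forall>\<^sub>F z in nhds x. norm (f z) < 1"
    by (rule order_tendstoD(2)[OF tendsto_norm[OF tendsto_nhds]])
      (use deriv[OF \<open>x \<in> S\<close>] DERIV_isCont \<open>f x = 0\<close> in auto)
  moreover have "\<forall>\<^sub>F z in nhds x. z \<in> S"
    using \<open>open S\<close> \<open>x \<in> S\<close> by (rule eventually_nhds_in_open)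
  ultimately have "\<forall>\<^sub>F z in nhds x. norm (a z) < M \<and> norm (f z) < 1 \<and> z \<in> S"
    by eventually_elim auto
  then obtain d where "d > 0"
    and d: "\<And>z. dist z x < d \<Longrightarrow> norm (a z) < M \<and> norm (f z) < 1 \<and> z \<in> S"
    by (auto simp: eventually_nhds_metric)
  define \<rho> where "\<rho> = min d (1 / (2 * M))"
  have "\<rho> > 0" using \<open>d > 0\<close> \<open>M > 0\<close> by (simp add: \<rho>_def)
  have "M * \<rho> \<le> M * (1 / (2 * M))"
    by (rule mult_left_mono) (use \<open>M > 0\<close> in \<open>auto simp: \<rho>_def\<close>)
  then have M\<rho>: "M * \<rho> \<le> 1/2" using \<open>M > 0\<close> by simp
  have on_ball: "norm (a z) < M" "norm (f z) < 1" "z \<in> S" if "z \<in> ball x \<rho>" for z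
    using d[of z] that by (auto simp: \<rho>_def dist_commute)
  have halving: "\<forall>z\<in>ball x \<rho>. norm (f z) \<le> (1/2) ^ n" for n
  proof (induction n)
    case 0
    then show ?case using on_ball(2) by (auto intro: less_imp_le)
  next
    case (Suc n)
    show ?case
    proof
      fix z assume z: "z \<in> ball x \<rho>"
      have "norm (f z - f x) \<le> (M * (1/2) ^ n) * norm (z - x)"
      proof (rule field_differentiable_bound[of "ball x \<rho>" f "\<lambda>y. a y * f y"])
        fix y assume y: "y \<in> ball x \<rho>"
        show "(f has_field_derivative a y * f y) (at y within ball x \<rho>)"
          using deriv[OF on_ball(3)[OF y]] has_field_derivative_at_within by blast
        show "norm (a y * f y) \<le> M * (1/2) ^ n"
          unfolding norm_mult
          using on_ball(1)[OF y] Suc.IH y \<open>M > 0\<close> by (intro mult_mono) auto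
      qed (use z \<open>\<rho> > 0\<close> in auto)
      also have "\<dots> \<le> (M * (1/2) ^ n) * \<rho>"
        using z \<open>M > 0\<close> by (intro mult_left_mono) (auto simp: dist_norm norm_minus_commute)
      also have "\<dots> = (M * \<rho>) * (1/2) ^ n"
        by simp
      also have "\<dots> \<le> (1/2) * (1/2) ^ n"
        using M\<rho> by (rule mult_right_mono) simp
      finally show "norm (f z) \<le> (1/2) ^ Suc n"
        using \<open>f x = 0\<close> by simp
    qed
  qed
  show thesis
  proof
    show "f z = 0" if "z \<in> ball x \<rho>" for z
    proof -
      have "(\<lambda>n. (1/2::real) ^ n) \<longlonglongrightarrow> 0" by (rule LIMSEQ_power_zero) simp
      then have "norm (f z) \<le> 0"
        using halving that by (intro LIMSEQ_le_const) auto
      then show ?thesis by simp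
    qed
  qed (use \<open>\<rho> > 0\<close> on_ball(3) in auto)
qed

text \<open>
  The weight-6 form \<open>8R\<^sup>2 + Q\<^sup>3\<close> is, up to nonzero factors, the discriminant of the cubic for
  \<open>\<mu>\<close> and of the quadratic for \<open>\<chi>\<close>.  Its logarithmic derivative is \<open>2P\<close>, because the terms in
  \<open>R Q\<^sup>2\<close> contributed by \<open>Q'\<close> and \<open>R'\<close> cancel.
\<close>

lemma chazy2_discriminant_zero_near_zero:
  assumes "open S" and sys: "chazy_system 2 S P Q R" and "x \<in> S"
    and "8 * (R x)^2 + (Q x)^3 = 0"
  obtains U where "open U" "x \<in> U" "U \<subseteq> S" "\<And>z. z \<in> U \<Longrightarrow> 8 * (R z)^2 + (Q z)^3 = 0"
proof (rule linear_ode_solution_zero_near_zero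
    [where f = "\<lambda>z. 8 * (R z)^2 + (Q z)^3" and a = "\<lambda>z. 2 * P z", OF assms(1,3)])
  fix z assume z: "z \<in> S"
  note [derivative_intros] = chazy_systemD[OF sys z]
  show "((\<lambda>z. 8 * (R z)^2 + (Q z)^3) has_field_derivative
          2 * P z * (8 * (R z)^2 + (Q z)^3)) (at z)"
    by (rule derivative_eq_intros refl)+ (simp add: field_simps power2_eq_square power3_eq_cube)
next
  show "isCont (\<lambda>z. 2 * P z) x"
    using DERIV_isCont[OF chazy_systemD(1)[OF sys \<open>x \<in> S\<close>]] by (intro continuous_intros)
qed (use assms in auto)

section \<open>Triples built from solutions of Riccati equations\<close>

text \<open>
  The Riccati equation alone yields the equations for the first two entries.  In the equation
  for the third entry the two sides differ by \<open>(Q\<^sup>2 - 4 R w)/12\<close>, which the algebraic relation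
  annihilates.
\<close>

lemma chazy2_involution:
  assumes sys: "chazy_system 2 S P Q R"
    and rel: "\<And>x. x \<in> S \<Longrightarrow> 4 * R x * w x = (Q x)^2"
    and riccati: "\<And>x. x \<in> S \<Longrightarrow>
      (w has_field_derivative P x * w x / 3 - Q x / 3 - (w x)^2 / 2) (at x)"
  shows "chazy_system 2 S (\<lambda>x. P x - w x) (\<lambda>x. - Q x - 2 * (w x)^2)
    (\<lambda>x. - R x - Q x * w x - (w x)^3)"
  unfolding chazy_system_def
proof (intro ballI conjI)
  fix x assume x: "x \<in> S"
  note [derivative_intros] = chazy_systemD[OF sys x] riccati[OF x]
  note rel = rel[OF x]
  show "((\<lambda>x. P x - w x) has_field_derivative
      (1/6) * ((P x - w x)^2 - (- Q x - 2 * (w x)^2))) (at x)"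
    by (rule derivative_eq_intros refl)+ (simp add: field_simps power2_eq_square power3_eq_cube)
  show "((\<lambda>x. - Q x - 2 * (w x)^2) has_field_derivative
      (2/3) * ((P x - w x) * (- Q x - 2 * (w x)^2) - (- R x - Q x * w x - (w x)^3))) (at x)"
    by (rule derivative_eq_intros refl)+ (simp add: field_simps power2_eq_square power3_eq_cube)
  show "((\<lambda>x. - R x - Q x * w x - (w x)^3) has_field_derivative
      (P x - w x) * (- R x - Q x * w x - (w x)^3)
        + 2^2 / (36 - 2^2) * (- Q x - 2 * (w x)^2)^2) (at x)"
    by (rule derivative_eq_intros refl)+
      (use rel in \<open>simp add: field_simps power2_eq_square power3_eq_cube\<close>)
qed

text \<open>
  With \<open>Q = -8\<mu>(4\<mu> + 3\<nu>)\<close> the functions \<open>P, \<mu>, \<nu>\<close> form a closed differential system, so the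
  claims become identities between polynomials in three independent variables.
\<close>

lemma chazy2_factored:
  assumes sys: "chazy_system 2 S P Q R"
    and Q: "\<And>x. x \<in> S \<Longrightarrow> Q x = - 8 * \<mu> x * (4 * \<mu> x + 3 * \<nu> x)"
    and \<mu>: "\<And>x. x \<in> S \<Longrightarrow>
      (\<mu> has_field_derivative \<mu> x * (P x / 3 + 2/3 * \<mu> x + \<nu> x)) (at x)"
    and \<nu>: "\<And>x. x \<in> S \<Longrightarrow>
      (\<nu> has_field_derivative \<nu> x * (P x / 3 - 4/3 * \<mu> x - \<nu> x)) (at x)"
  shows "chazy_system 2 S (\<lambda>x. P x - 2 * \<nu> x)
    (\<lambda>x. - 8 * (\<mu> x + \<nu> x) * (4 * \<mu> x + \<nu> x))
    (\<lambda>x. 64 * (\<mu> x)^3 + 120 * (\<mu> x)^2 * \<nu> x + 48 * \<mu> x * (\<nu> x)^2 - 8 * (\<nu> x)^3)"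
  unfolding chazy_system_def
proof (intro ballI conjI)
  fix x assume x: "x \<in> S"
  note [derivative_intros] = chazy_systemD(1)[OF sys x] \<mu>[OF x] \<nu>[OF x]
  note Q = Q[OF x]
  show "((\<lambda>x. P x - 2 * \<nu> x) has_field_derivative
      (1/6) * ((P x - 2 * \<nu> x)^2 - (- 8 * (\<mu> x + \<nu> x) * (4 * \<mu> x + \<nu> x)))) (at x)"
    by (rule derivative_eq_intros refl)+
      (simp add: Q field_simps power2_eq_square power3_eq_cube)
  show "((\<lambda>x. - 8 * (\<mu> x + \<nu> x) * (4 * \<mu> x + \<nu> x)) has_field_derivative
      (2/3) * ((P x - 2 * \<nu> x) * (- 8 * (\<mu> x + \<nu> x) * (4 * \<mu> x + \<nu> x))
        - (64 * (\<mu> x)^3 + 120 * (\<mu> x)^2 * \<nu> x + 48 * \<mu> x * (\<nu> x)^2 - 8 * (\<nu> x)^3))) (at x)"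
    by (rule derivative_eq_intros refl)+
      (simp add: field_simps power2_eq_square power3_eq_cube)
  show "((\<lambda>x. 64 * (\<mu> x)^3 + 120 * (\<mu> x)^2 * \<nu> x + 48 * \<mu> x * (\<nu> x)^2 - 8 * (\<nu> x)^3)
      has_field_derivative
      (P x - 2 * \<nu> x) *
        (64 * (\<mu> x)^3 + 120 * (\<mu> x)^2 * \<nu> x + 48 * \<mu> x * (\<nu> x)^2 - 8 * (\<nu> x)^3)
        + 2^2 / (36 - 2^2) * (- 8 * (\<mu> x + \<nu> x) * (4 * \<mu> x + \<nu> x))^2) (at x)"
    by (rule derivative_eq_intros refl)+
      (simp add: field_simps power2_eq_square power3_eq_cube)
qed

text \<open>
  Here \<open>\<xi>\<close> is the root \<open>\<chi>\<close> of the quadratic.  In the equation for the third entry the two sides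
  differ by \<open>3/64 (32 (Q \<xi>\<^sup>2 - R \<xi>) - Q\<^sup>2)\<close>; the other two follow from the Riccati equation.
\<close>

lemma chazy2_to_chazy3:
  assumes sys: "chazy_system 2 S P Q R"
    and rel: "\<And>x. x \<in> S \<Longrightarrow> 32 * (Q x * (\<xi> x)^2 - R x * \<xi> x) = (Q x)^2"
    and riccati: "\<And>x. x \<in> S \<Longrightarrow>
      (\<xi> has_field_derivative P x * \<xi> x / 3 + 2/3 * (\<xi> x)^2 + Q x / 24) (at x)"
  shows "chazy_system 3 S (\<lambda>x. P x + \<xi> x) (\<lambda>x. 3/4 * Q x - 3 * (\<xi> x)^2)
    (\<lambda>x. 3/4 * R x + 9/8 * Q x * \<xi> x + 3 * (\<xi> x)^3)"
  unfolding chazy_system_def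
proof (intro ballI conjI)
  fix x assume x: "x \<in> S"
  note [derivative_intros] = chazy_systemD[OF sys x] riccati[OF x]
  note rel = rel[OF x]
  show "((\<lambda>x. P x + \<xi> x) has_field_derivative
      (1/6) * ((P x + \<xi> x)^2 - (3/4 * Q x - 3 * (\<xi> x)^2))) (at x)"
    by (rule derivative_eq_intros refl)+ (simp add: field_simps power2_eq_square power3_eq_cube)
  show "((\<lambda>x. 3/4 * Q x - 3 * (\<xi> x)^2) has_field_derivative
      (2/3) * ((P x + \<xi> x) * (3/4 * Q x - 3 * (\<xi> x)^2)
        - (3/4 * R x + 9/8 * Q x * \<xi> x + 3 * (\<xi> x)^3))) (at x)"
    by (rule derivative_eq_intros refl)+ (simp add: field_simps power2_eq_square power3_eq_cube)
  show "((\<lambda>x. 3/4 * R x + 9/8 * Q x * \<xi> x + 3 * (\<xi> x)^3) has_field_derivative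
      (P x + \<xi> x) * (3/4 * R x + 9/8 * Q x * \<xi> x + 3 * (\<xi> x)^3)
        + 3^2 / (36 - 3^2) * (3/4 * Q x - 3 * (\<xi> x)^2)^2) (at x)"
    by (rule derivative_eq_intros refl)+
      (use rel in \<open>simp add: field_simps power2_eq_square power3_eq_cube, algebra\<close>)
qed

section \<open>Differential equations for the branches\<close>

text \<open>
  Differentiating the cubic expresses \<open>3(\<mu>\<^sup>2 + Q/32) \<mu>'\<close> by \<open>P, Q, R, \<mu>\<close>, and modulo the cubic that
  expression is divisible by \<open>\<mu>\<^sup>2 + Q/32\<close>; this settles simple roots.  At a double root
  \<open>8R\<^sup>2 + Q\<^sup>3\<close> vanishes, hence also nearby, where the cubic has the double root \<open>-R/(2Q)\<close> and the
  simple root \<open>R/Q\<close>.  These are distinct since \<open>R \<noteq> 0\<close>, so by continuity the branch stays on the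
  double root.
\<close>

lemma chazy2_cubic_root_riccati:
  assumes "open S" and sys: "chazy_system 2 S P Q R"
    and R_nz: "\<And>x. x \<in> S \<Longrightarrow> R x \<noteq> 0"
    and diff: "\<And>x. x \<in> S \<Longrightarrow> \<mu> field_differentiable (at x)"
    and cubic: "\<And>x. x \<in> S \<Longrightarrow> (\<mu> x)^3 + 3/32 * Q x * \<mu> x + R x / 32 = 0"
    and x: "x \<in> S"
  shows "(\<mu> has_field_derivative P x * \<mu> x / 3 - 2/3 * ((\<mu> x)^2 + Q x / 16)) (at x)"
proof -
  note system = chazy_systemD[OF sys x]
  obtain D where D: "(\<mu> has_field_derivative D) (at x)"
    using diff[OF x] by (auto simp: field_differentiable_def)
  note [derivative_intros] = system D
  show ?thesis
  proof (cases "(\<mu> x)^2 + Q x / 32 = 0")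
    case False
    have "((\<lambda>x. (\<mu> x)^3 + 3/32 * Q x * \<mu> x + R x / 32) has_field_derivative
        3 * (\<mu> x)^2 * D + 3/32 * (2/3 * (P x * Q x - R x) * \<mu> x + Q x * D)
          + (P x * R x + (Q x)^2 / 8) / 32) (at x)"
      by (rule derivative_eq_intros refl nonzero_denominator)+ (simp add: field_simps power2_eq_square)
    moreover have "((\<lambda>x. (\<mu> x)^3 + 3/32 * Q x * \<mu> x + R x / 32) has_field_derivative 0) (at x)"
      using cubic by (intro has_field_derivative_transform_within_open[OF DERIV_const[of 0] \<open>open S\<close> x]) auto
    ultimately have "3 * (\<mu> x)^2 * D + 3/32 * (2/3 * (P x * Q x - R x) * \<mu> x + Q x * D)
          + (P x * R x + (Q x)^2 / 8) / 32 = 0"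
      by (rule DERIV_unique)
    moreover have "R x = - 32 * (\<mu> x)^3 - 3 * Q x * \<mu> x"
      using cubic[OF x] by (simp add: field_simps eq_neg_iff_add_eq_0)
    ultimately have "((\<mu> x)^2 + Q x / 32) * (D - (P x * \<mu> x / 3 - 2/3 * ((\<mu> x)^2 + Q x / 16))) = 0"
      by (simp add: field_simps power2_eq_square power3_eq_cube) algebra
    then have "D = P x * \<mu> x / 3 - 2/3 * ((\<mu> x)^2 + Q x / 16)"
      using False by simp
    then show ?thesis using D by simp
  next
    case True
    then have Qx: "Q x = - 32 * (\<mu> x)^2"
      by (simp add: field_simps eq_neg_iff_add_eq_0)
    have Rx: "R x = 64 * (\<mu> x)^3"
      using cubic[OF x] unfolding Qx
      by (simp add: field_simps power2_eq_square power3_eq_cube)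
    have "8 * (R x)^2 + (Q x)^3 = 0"
      unfolding Qx Rx by (simp add: power2_eq_square power3_eq_cube)
    then obtain U where U: "open U" "x \<in> U" "U \<subseteq> S"
      and disc: "\<And>z. z \<in> U \<Longrightarrow> 8 * (R z)^2 + (Q z)^3 = 0"
      by (rule chazy2_discriminant_zero_near_zero[OF \<open>open S\<close> sys x]) blast
    \<comment> \<open>The branch keeps away from the simple root \<open>R/Q\<close> near \<open>x\<close>.\<close>
    have "isCont (\<lambda>z. Q z * \<mu> z - R z) x"
      using DERIV_isCont[OF system(2)] DERIV_isCont[OF system(3)] DERIV_isCont[OF D]
      by (intro continuous_intros)
    moreover have "Q x * \<mu> x - R x \<noteq> 0"
      using R_nz[OF x] unfolding Qx Rx by (simp add: power2_eq_square power3_eq_cube)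
    ultimately have "\<forall>\<^sub>F z in nhds x. Q z * \<mu> z - R z \<noteq> 0"
      unfolding isCont_def tendsto_at_iff_tendsto_nhds[where g = "\<lambda>z. Q z * \<mu> z - R z"]
      by (rule tendsto_imp_eventually_ne)
    moreover have "\<forall>\<^sub>F z in nhds x. z \<in> U"
      using U by (intro eventually_nhds_in_open)
    ultimately have root: "\<forall>\<^sub>F z in nhds x. \<mu> z = - (R z / (2 * Q z))"
    proof eventually_elim
      case (elim z)
      have z: "z \<in> S" using elim U by auto
      have "Q z \<noteq> 0" using disc[OF elim(2)] R_nz[OF z] by auto
      \<comment> \<open>Where \<open>8R\<^sup>2 = -Q\<^sup>3\<close>, this product is \<open>4Q\<^sup>3\<close> times the cubic.\<close>
      have "(2 * Q z * \<mu> z + R z)^2 * (Q z * \<mu> z - R z) = 0"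
        using disc[OF elim(2)] cubic[OF z]
        by (simp add: field_simps) algebra
      then have "2 * Q z * \<mu> z + R z = 0" using elim by simp
      then show ?case using \<open>Q z \<noteq> 0\<close> by (simp add: field_simps eq_neg_iff_add_eq_0)
    qed
    have "\<mu> x \<noteq> 0" using Rx R_nz[OF x] by auto
    then have "Q x \<noteq> 0" by (simp add: Qx)
    note nonzero = nonzero_denominator this
    have "((\<lambda>z. - (R z / (2 * Q z))) has_field_derivative
        P x * \<mu> x / 3 - 2/3 * ((\<mu> x)^2 + Q x / 16)) (at x)"
      by ((rule derivative_eq_intros refl nonzero)+,
          use \<open>\<mu> x \<noteq> 0\<close> in \<open>simp_all add: Qx Rx field_simps power2_eq_square power3_eq_cube\<close>)
    then show ?thesis
      using DERIV_cong_ev[OF refl root refl] by blast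
  qed
qed

text \<open>
  The radicand equals \<open>(8R\<^sup>2 + Q\<^sup>3)/(8Q\<^sup>2)\<close>, so where it is nonzero its logarithmic derivative is
  \<open>2P - 2Q'/Q = 2(P/3 + 2R/(3Q))\<close>, and \<open>s\<close> has half of it.  Where \<open>s\<close> vanishes, it vanishes
  nearby.
\<close>

lemma chazy2_sqrt_discriminant_deriv:
  assumes "open S" and sys: "chazy_system 2 S P Q R"
    and Q_nz: "\<And>x. x \<in> S \<Longrightarrow> Q x \<noteq> 0"
    and diff: "\<And>x. x \<in> S \<Longrightarrow> s field_differentiable (at x)"
    and sqrt: "\<And>x. x \<in> S \<Longrightarrow> (s x)^2 = (R x)^2 / (Q x)^2 + Q x / 8"
    and x: "x \<in> S"
  shows "(s has_field_derivative s x * (P x / 3 + 2/3 * (R x / Q x))) (at x)"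
proof -
  have disc_iff: "s z = 0 \<longleftrightarrow> 8 * (R z)^2 + (Q z)^3 = 0" if "z \<in> S" for z
  proof -
    have "8 * (Q z)^2 * (s z)^2 = 8 * (R z)^2 + (Q z)^3"
      using sqrt[OF that] Q_nz[OF that] by (simp add: field_simps power2_eq_square power3_eq_cube)
    then show ?thesis
      using Q_nz[OF that] by (metis mult_eq_0_iff power_eq_0_iff zero_neq_numeral zero_power2)
  qed
  show ?thesis
  proof (cases "s x = 0")
    case False
    note system = chazy_systemD[OF sys x]
    obtain D where D: "(s has_field_derivative D) (at x)"
      using diff[OF x] by (auto simp: field_differentiable_def)
    note [derivative_intros] = system D
    note nonzero = nonzero_denominator Q_nz[OF x]
    have "((\<lambda>x. (s x)^2) has_field_derivative 2 * s x * D) (at x)"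
      by (rule derivative_eq_intros refl nonzero)+ simp
    moreover have "((\<lambda>x. (R x)^2 / (Q x)^2 + Q x / 8) has_field_derivative
        2 * ((R x)^2 / (Q x)^2 + Q x / 8) * (P x / 3 + 2/3 * (R x / Q x))) (at x)"
      by (rule derivative_eq_intros refl nonzero)+
        (use Q_nz[OF x] in \<open>simp_all add: field_simps power2_eq_square power3_eq_cube\<close>)
    then have "((\<lambda>x. (s x)^2) has_field_derivative
        2 * ((R x)^2 / (Q x)^2 + Q x / 8) * (P x / 3 + 2/3 * (R x / Q x))) (at x)"
      by (rule has_field_derivative_transform_within_open[OF _ \<open>open S\<close> x]) (simp add: sqrt)
    ultimately have "2 * s x * D = 2 * (s x)^2 * (P x / 3 + 2/3 * (R x / Q x))"
      using DERIV_unique sqrt[OF x] by metis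
    then have "D = s x * (P x / 3 + 2/3 * (R x / Q x))"
      using False by (simp add: power2_eq_square)
    then show ?thesis using D by simp
  next
    case True
    then obtain U where U: "open U" "x \<in> U" "U \<subseteq> S"
      and disc: "\<And>z. z \<in> U \<Longrightarrow> 8 * (R z)^2 + (Q z)^3 = 0"
      using chazy2_discriminant_zero_near_zero[OF \<open>open S\<close> sys x] disc_iff[OF x] by metis
    have "(s has_field_derivative 0) (at x)"
      using disc disc_iff U
      by (intro has_field_derivative_transform_within_open[OF DERIV_const[of 0] U(1,2)]) auto
    then show ?thesis using True by simp
  qed
qed

section \<open>The transformations\<close>

theorem theorem3p1:
  fixes P Q R :: "'a::real_normed_field \<Rightarrow> 'a" and S :: "'a set"
  assumes "open S"
    and "chazy_system 2 S P Q R"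
  shows
    "((\<forall>x\<in>S. R x \<noteq> 0) \<longrightarrow>
        chazy_system 2 S
          (\<lambda>x. P x - (Q x)^2 / (4 * R x))
          (\<lambda>x. - Q x - (Q x)^4 / (8 * (R x)^2))
          (\<lambda>x. - R x - (Q x)^3 / (4 * R x) - (Q x)^6 / (64 * (R x)^3)))
   \<and> (\<forall>\<mu> \<nu>.
        (\<forall>x\<in>S. R x \<noteq> 0 \<and> \<mu> x \<noteq> 0) \<longrightarrow>
        (\<forall>x\<in>S. \<mu> field_differentiable (at x) \<and> \<nu> field_differentiable (at x)) \<longrightarrow>
        (\<forall>x\<in>S. (\<mu> x)^3 + 3/32 * Q x * \<mu> x + R x / 32 = 0) \<longrightarrow>
        (\<forall>x\<in>S. (\<nu> x)^3 - 1/8 * ((Q x)^2 / R x) * (\<nu> x)^2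
                 - 1/108 * ((Q x)^3 / R x) - 2/27 * R x = 0) \<longrightarrow>
        (\<forall>x\<in>S. \<nu> x = - (4/3) * \<mu> x - Q x / (24 * \<mu> x)) \<longrightarrow>
        chazy_system 2 S
          (\<lambda>x. P x - 2 * \<nu> x)
          (\<lambda>x. 5/3 * Q x + 64/3 * (\<mu> x)^2 - 8 * (\<nu> x)^2)
          (\<lambda>x. - (7/27) * R x - 4/3 * Q x * \<mu> x - 2 * Q x * \<nu> x
                - (Q x)^2 / R x * (\<nu> x)^2 - 2/27 * ((Q x)^3 / R x)))
   \<and> (\<forall>s. \<forall>\<epsilon>\<in>{1, -1}.
        (\<forall>x\<in>S. Q x \<noteq> 0) \<longrightarrow>
        (\<forall>x\<in>S. s field_differentiable (at x)) \<longrightarrow>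
        (\<forall>x\<in>S. (s x)^2 = (R x)^2 / (Q x)^2 + Q x / 8) \<longrightarrow>
        (let chi = (\<lambda>x. R x / (2 * Q x) + \<epsilon> * (1/2) * s x) in
         chazy_system 3 S
          (\<lambda>x. P x + chi x)
          (\<lambda>x. 3/4 * Q x - 3 * (chi x)^2)
          (\<lambda>x. 3/4 * R x + 9/8 * Q x * chi x + 3 * (chi x)^3)))"
proof (intro conjI allI impI ballI)
  note sys = assms(2)
  {
    assume R_nz: "\<forall>x\<in>S. R x \<noteq> 0"
    define w where "w = (\<lambda>x. (Q x)^2 / (4 * R x))"
    have "chazy_system 2 S (\<lambda>x. P x - w x) (\<lambda>x. - Q x - 2 * (w x)^2)
        (\<lambda>x. - R x - Q x * w x - (w x)^3)"
    proof (rule chazy2_involution[OF sys])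
      fix x assume x: "x \<in> S"
      then have "R x \<noteq> 0" using R_nz by blast
      then show "4 * R x * w x = (Q x)^2"
        by (simp add: w_def)
      note [derivative_intros] = chazy_systemD[OF sys x]
      note nonzero = nonzero_denominator \<open>R x \<noteq> 0\<close>
      show "(w has_field_derivative P x * w x / 3 - Q x / 3 - (w x)^2 / 2) (at x)"
        unfolding w_def
        by (rule derivative_eq_intros refl nonzero)+
          (use \<open>R x \<noteq> 0\<close> in \<open>simp_all add: field_simps power2_eq_square power3_eq_cube\<close>)
    qed
    then show "chazy_system 2 S
          (\<lambda>x. P x - (Q x)^2 / (4 * R x))
          (\<lambda>x. - Q x - (Q x)^4 / (8 * (R x)^2))
          (\<lambda>x. - R x - (Q x)^3 / (4 * R x) - (Q x)^6 / (64 * (R x)^3))"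
      by (rule chazy_system_cong_open[OF \<open>open S\<close>])
        (simp_all add: w_def power_divide power_mult_distrib eval_nat_numeral)
  next
    fix \<mu> \<nu>
    assume nz: "\<forall>x\<in>S. R x \<noteq> 0 \<and> \<mu> x \<noteq> 0"
      and diff: "\<forall>x\<in>S. \<mu> field_differentiable (at x) \<and> \<nu> field_differentiable (at x)"
      and cubic_\<mu>: "\<forall>x\<in>S. (\<mu> x)^3 + 3/32 * Q x * \<mu> x + R x / 32 = 0"
      and cubic_\<nu>: "\<forall>x\<in>S. (\<nu> x)^3 - 1/8 * ((Q x)^2 / R x) * (\<nu> x)^2
                 - 1/108 * ((Q x)^3 / R x) - 2/27 * R x = 0"
      and \<nu>_eq: "\<forall>x\<in>S. \<nu> x = - (4/3) * \<mu> x - Q x / (24 * \<mu> x)"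
    have Q_eq: "Q x = - 8 * \<mu> x * (4 * \<mu> x + 3 * \<nu> x)" if "x \<in> S" for x
    proof -
      have "24 * \<mu> x * \<nu> x = - 32 * (\<mu> x)^2 - Q x"
        using \<nu>_eq nz that by (simp add: field_simps power2_eq_square)
      then show ?thesis by algebra
    qed
    have R_eq: "R x = 64 * (\<mu> x)^3 + 72 * (\<mu> x)^2 * \<nu> x" if "x \<in> S" for x
    proof -
      have "R x = - 32 * (\<mu> x)^3 - 3 * Q x * \<mu> x"
        using cubic_\<mu> that by (simp add: field_simps eq_neg_iff_add_eq_0)
      then show ?thesis
        by (simp add: Q_eq[OF that] field_simps power2_eq_square power3_eq_cube)
    qed
    have \<mu>': "(\<mu> has_field_derivative \<mu> x * (P x / 3 + 2/3 * \<mu> x + \<nu> x)) (at x)"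
      if x: "x \<in> S" for x
    proof -
      have "(\<mu> has_field_derivative P x * \<mu> x / 3 - 2/3 * ((\<mu> x)^2 + Q x / 16)) (at x)"
        by (rule chazy2_cubic_root_riccati[OF \<open>open S\<close> sys]) (use nz diff cubic_\<mu> x in auto)
      then show ?thesis
        by (rule DERIV_cong) (simp add: Q_eq[OF x] field_simps power2_eq_square)
    qed
    have \<nu>': "(\<nu> has_field_derivative \<nu> x * (P x / 3 - 4/3 * \<mu> x - \<nu> x)) (at x)"
      if x: "x \<in> S" for x
    proof -
      note [derivative_intros] = chazy_systemD[OF sys x] \<mu>'[OF x]
      have "\<mu> x \<noteq> 0" using nz x by blast
      note nonzero = nonzero_denominator this
      have "((\<lambda>x. - (4/3) * \<mu> x - Q x / (24 * \<mu> x)) has_field_derivative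
          \<nu> x * (P x / 3 - 4/3 * \<mu> x - \<nu> x)) (at x)"
        by (rule derivative_eq_intros refl nonzero)+
          (use \<open>\<mu> x \<noteq> 0\<close> in \<open>simp_all add: Q_eq[OF x] R_eq[OF x] field_simps power2_eq_square power3_eq_cube\<close>)
      then show ?thesis
        by (rule has_field_derivative_transform_within_open[OF _ \<open>open S\<close> x]) (use \<nu>_eq in simp)
    qed
    show "chazy_system 2 S
          (\<lambda>x. P x - 2 * \<nu> x)
          (\<lambda>x. 5/3 * Q x + 64/3 * (\<mu> x)^2 - 8 * (\<nu> x)^2)
          (\<lambda>x. - (7/27) * R x - 4/3 * Q x * \<mu> x - 2 * Q x * \<nu> x
                - (Q x)^2 / R x * (\<nu> x)^2 - 2/27 * ((Q x)^3 / R x))"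
    proof (rule chazy_system_cong_open[OF \<open>open S\<close> chazy2_factored[OF sys Q_eq \<mu>' \<nu>']])
      fix x assume x: "x \<in> S"
      show "5/3 * Q x + 64/3 * (\<mu> x)^2 - 8 * (\<nu> x)^2
          = - 8 * (\<mu> x + \<nu> x) * (4 * \<mu> x + \<nu> x)"
        by (simp add: Q_eq[OF x] field_simps power2_eq_square)
      \<comment> \<open>The denominator \<open>R\<close> occurs only within 8 times the cubic of \<open>\<nu>\<close>, which vanishes.\<close>
      have "- (7/27) * R x - 4/3 * Q x * \<mu> x - 2 * Q x * \<nu> x
                - (Q x)^2 / R x * (\<nu> x)^2 - 2/27 * ((Q x)^3 / R x)
          = R x / 3 - 4/3 * Q x * \<mu> x - 2 * Q x * \<nu> x - 8 * (\<nu> x)^3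
            + 8 * ((\<nu> x)^3 - 1/8 * ((Q x)^2 / R x) * (\<nu> x)^2
                 - 1/108 * ((Q x)^3 / R x) - 2/27 * R x)"
        by (simp add: algebra_simps)
      also have "\<dots> = R x / 3 - 4/3 * Q x * \<mu> x - 2 * Q x * \<nu> x - 8 * (\<nu> x)^3"
        by (simp only: bspec[OF cubic_\<nu> x] mult_zero_right add_0_right)
      also have "\<dots> = 64 * (\<mu> x)^3 + 120 * (\<mu> x)^2 * \<nu> x + 48 * \<mu> x * (\<nu> x)^2 - 8 * (\<nu> x)^3"
        by (simp add: Q_eq[OF x] R_eq[OF x] field_simps power2_eq_square power3_eq_cube)
      finally show "- (7/27) * R x - 4/3 * Q x * \<mu> x - 2 * Q x * \<nu> x
                - (Q x)^2 / R x * (\<nu> x)^2 - 2/27 * ((Q x)^3 / R x)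
          = 64 * (\<mu> x)^3 + 120 * (\<mu> x)^2 * \<nu> x + 48 * \<mu> x * (\<nu> x)^2 - 8 * (\<nu> x)^3" .
    qed simp_all
  next
    fix s :: "'a \<Rightarrow> 'a" and \<epsilon> :: 'a
    assume \<epsilon>: "\<epsilon> \<in> {1, -1}"
      and Q_nz: "\<forall>x\<in>S. Q x \<noteq> 0"
      and diff: "\<forall>x\<in>S. s field_differentiable (at x)"
      and sqrt: "\<forall>x\<in>S. (s x)^2 = (R x)^2 / (Q x)^2 + Q x / 8"
    define \<xi> where "\<xi> = (\<lambda>x. R x / (2 * Q x) + \<epsilon> * (1/2) * s x)"
    have "chazy_system 3 S (\<lambda>x. P x + \<xi> x) (\<lambda>x. 3/4 * Q x - 3 * (\<xi> x)^2)
        (\<lambda>x. 3/4 * R x + 9/8 * Q x * \<xi> x + 3 * (\<xi> x)^3)"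
    proof (rule chazy2_to_chazy3[OF sys])
      fix x assume x: "x \<in> S"
      then have Qx: "Q x \<noteq> 0" using Q_nz by blast
      define f where "f = R x / Q x"
      have "\<epsilon> * s x = 2 * \<xi> x - f"
        by (simp add: \<xi>_def f_def field_simps)
      \<comment> \<open>Only \<open>\<epsilon>\<^sup>2 = 1\<close> matters, so both signs are treated at once.\<close>
      moreover have "(\<epsilon> * s x)^2 = f^2 + Q x / 8"
        using sqrt x \<epsilon> by (auto simp: f_def power_divide)
      ultimately have "(2 * \<xi> x - f)^2 = f^2 + Q x / 8"
        by simp
      then have "(\<xi> x)^2 - f * \<xi> x = Q x / 32"
        by (simp add: field_simps power2_eq_square)
      then have quadratic: "(\<xi> x)^2 - R x / Q x * \<xi> x = Q x / 32"
        by (simp add: f_def)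
      then show "32 * (Q x * (\<xi> x)^2 - R x * \<xi> x) = (Q x)^2"
        using Qx by (simp add: field_simps power2_eq_square)
      have s': "(s has_field_derivative s x * (P x / 3 + 2/3 * (R x / Q x))) (at x)"
        by (rule chazy2_sqrt_discriminant_deriv[OF \<open>open S\<close> sys]) (use Q_nz diff sqrt x in auto)
      note [derivative_intros] = chazy_systemD[OF sys x] s'
      note nonzero = nonzero_denominator Qx
      have \<xi>': "(\<xi> has_field_derivative P x * \<xi> x / 3 + 2/3 * (R x / Q x * \<xi> x) + Q x / 16) (at x)"
        unfolding \<xi>_def
        by (rule derivative_eq_intros refl nonzero)+
          (use Qx in \<open>simp_all add: field_simps power2_eq_square\<close>)
      have "R x / Q x * \<xi> x = (\<xi> x)^2 - Q x / 32"
        unfolding quadratic[symmetric] by simp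
      then show "(\<xi> has_field_derivative P x * \<xi> x / 3 + 2/3 * (\<xi> x)^2 + Q x / 24) (at x)"
        by (intro DERIV_cong[OF \<xi>']) (simp only:, simp add: field_simps)
    qed
    then show "let chi = (\<lambda>x. R x / (2 * Q x) + \<epsilon> * (1/2) * s x) in
         chazy_system 3 S
          (\<lambda>x. P x + chi x)
          (\<lambda>x. 3/4 * Q x - 3 * (chi x)^2)
          (\<lambda>x. 3/4 * R x + 9/8 * Q x * chi x + 3 * (chi x)^3)"
      by (simp add: \<xi>_def Let_def)
  }
qed

end
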